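(* The array $g_{n,k}(q)$ defined in the context from the $q$-Fibonacci polynomials satisfies $g_{1,1}(q)=g_{2,1}(q)=1$, and, for every integer $n\ge 1$, $$g_{2n,k}(q) = g_{2n,k+1}(q)+q^{k-1}g_{2n-1,k}(q)\qquad (1\le k\le n)$$ and $$g_{2n+1,k}(q) = q^{k-1}g_{2n,k}(q)+g_{2n+1,k-1}(q)\qquad (1\le k\le n+1).$$
   Context: Let $q$ be an indeterminate and $\begin{bmatrix} n\\k\end{bmatrix}$ the Gaussian $q$-binomial coefficient. The (Carlitz) $q$-Fibonacci polynomials are $F_0(s,q)=0$ and $F_n(s,q)=\sum_{k=0}^{\lfloor (n-1)/2\rfloor}q^{2\binom{k}{2}}\begin{bmatrix} n-1-k\\k\end{bmatrix}s^k$ for $n\ge 1$; $F_n\left(s,\frac1q\right)$ is obtained by replacing $q$ by $1/q$ (also in the $q$-binomial coefficients). Since $F_{2n+1}\left(s,\frac1q\right)$ has degree $n$ in $s$, there is a unique $\mathbb{Q}(q)$-linear functional $L$ on $\mathbb{Q}(q)[s]$ with $L\left(F_1\left(s,\frac1q\right)\right)=1$ and $L\left(F_{2n+1}\left(s,\frac1q\right)\right)=0$ for $n\ge 1$. Define $g_{2n,k}(q)=(-1)^nq^{2\binom{k-1}{2}}L\left(s^{n+1-k}F_{2k-1}\left(s,\frac1q\right)\right)$ for $n\ge 1$, $1\le k\le n$, and $g_{2n+1,k}(q)=(-1)^nq^{(k-1)^2}L\left(s^{n+1-k}F_{2k}\left(s,\frac1q\right)\right)$ for $n\ge 0$, $1\le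 k\le n+1$; all other values $g_{i,k}(q)$ are $0$. *)

theory Defs
  imports "HOL-Computational_Algebra.Computational_Algebra"
begin

type_synonym ratfun = "rat poly fract"

definition q :: ratfun where
  "q = Fract [:0, 1:] 1"

text \<open>
  The base \<open>x\<close> is an argument below, so that replacing \<open>q\<close> by \<open>1/q\<close> is evaluation at
  \<open>x = 1 / q\<close>. Only these two bases are used; there no \<open>qnum x n\<close> with \<open>n > 0\<close> vanishes.
\<close>

definition qnum :: "'a::field \<Rightarrow> nat \<Rightarrow> 'a" where
  "qnum x n = (\<Sum>i<n. x ^ i)"

definition qfact :: "'a::field \<Rightarrow> nat \<Rightarrow> 'a" where
  "qfact x n = (\<Prod>m=1..n. qnum x m)"

definition qbinom :: "'a::field \<Rightarrow> nat \<Rightarrow> nat \<Rightarrow> 'a" where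
  "qbinom x n k = (if k \<le> n then qfact x n / (qfact x k * qfact x (n - k)) else 0)"

text \<open>The Carlitz \<open>q\<close>-Fibonacci polynomials, as polynomials in the indeterminate \<open>s\<close>.\<close>

definition qfib :: "nat \<Rightarrow> 'a::field \<Rightarrow> 'a poly" where
  "qfib n x = (if n = 0 then 0 else
     (\<Sum>k\<le>(n - 1) div 2. monom (x ^ (2 * (k choose 2)) * qbinom x (n - 1 - k) k) k))"

definition L :: "ratfun poly \<Rightarrow> ratfun" where
  "L = (THE l. Vector_Spaces.linear smult (*) l \<and>
          l (qfib 1 (1 / q)) = 1 \<and>
          (\<forall>n\<ge>1. l (qfib (2 * n + 1) (1 / q)) = 0))"

text \<open>In the odd case \<open>i = 2n + 1\<close>, so \<open>i div 2 = n\<close> as well.\<close>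

definition g :: "nat \<Rightarrow> nat \<Rightarrow> ratfun" where
  "g i k = (let n = i div 2 in
     if even i then
       (if 1 \<le> k \<and> k \<le> n
        then (- 1) ^ n * q ^ (2 * ((k - 1) choose 2)) *
               L (monom 1 (n + 1 - k) * qfib (2 * k - 1) (1 / q))
        else 0)
     else
       (if 1 \<le> k \<and> k \<le> n + 1
        then (- 1) ^ n * q ^ ((k - 1)\<^sup>2) *
               L (monom 1 (n + 1 - k) * qfib (2 * k) (1 / q))
        else 0))"

end

(* The Gaussian Pascal rule gives F_{n+3} = F_{n+2} + x^n s F_{n+1}. At x = 1/q, multiplying by a
   power of s and applying L turns this into the two recurrences for g; the powers of q in the
   definition of g are what normalizes the coefficients. At the boundary the out-of-range entry
   is 0 by definition of g, and it matches the vanishing of L (F_{2n+1}). *)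
theory Submission
  imports Defs
begin

section \<open>Functionals prescribed on a graded sequence of polynomials\<close>

text \<open>The values forced on the powers of \<open>s\<close>: when \<open>P n\<close> has degree
  \<open>n\<close>, the conditions \<open>l (P n) = v n\<close> form a triangular system, solved
  here for its top unknown.\<close>

fun graded_moment :: "(nat \<Rightarrow> 'a::field poly) \<Rightarrow> (nat \<Rightarrow> 'a) \<Rightarrow> nat \<Rightarrow> 'a" where
  "graded_moment P v n =
     (v n - (\<Sum>k<n. coeff (P n) k * graded_moment P v k)) / coeff (P n) n"

declare graded_moment.simps [simp del]

lemma linear_smult_iff:
  fixes l :: "'a::field poly \<Rightarrow> 'a"
  shows "Vector_Spaces.linear smult (*) l \<longleftrightarrow>
    (\<forall>p r. l (p + r) = l p + l r) \<and> (\<forall>c p. l (smult c p) = c * l p)"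
proof -
  have "vector_space (smult :: 'a \<Rightarrow> _)"
    by unfold_locales (auto simp: smult_add_right smult_add_left)
  moreover have "vector_space ((*) :: 'a \<Rightarrow> 'a \<Rightarrow> 'a)"
    by unfold_locales (auto simp: algebra_simps)
  ultimately show ?thesis
    by (auto simp: Vector_Spaces.linear_def module_hom_def module_hom_axioms_def
        vector_space_def module_def)
qed

text \<open>Padding with zero coefficients puts polynomials of different degrees on one summation
  range, as additivity requires.\<close>

lemma moment_functional_eq_sum:
  fixes c :: "nat \<Rightarrow> 'a::comm_semiring_0"
  assumes "degree p \<le> N"
  shows "(\<Sum>i\<le>degree p. coeff p i * c i) = (\<Sum>i\<le>N. coeff p i * c i)"
  by (rule sum.mono_neutral_left) (use assms in \<open>auto simp: coeff_eq_0\<close>)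

lemma linear_moment_functional:
  fixes c :: "nat \<Rightarrow> 'a::field"
  shows "Vector_Spaces.linear smult (*) (\<lambda>p. \<Sum>i\<le>degree p. coeff p i * c i)"
    (is "Vector_Spaces.linear _ _ ?l")
  unfolding linear_smult_iff
proof (intro conjI allI)
  fix p r :: "'a poly"
  define N where "N = max (degree p) (degree r)"
  have N: "degree (p + r) \<le> N" "degree p \<le> N" "degree r \<le> N"
    by (auto simp: N_def degree_add_le_max)
  show "?l (p + r) = ?l p + ?l r"
    unfolding N[THEN moment_functional_eq_sum] by (simp add: distrib_right sum.distrib)
next
  fix a :: 'a and p :: "'a poly"
  show "?l (smult a p) = a * ?l p"
    by (simp add: moment_functional_eq_sum[OF degree_smult_le] sum_distrib_left mult.assoc)
qed

text \<open>The functional with moments \<open>graded_moment P v\<close> works, since the recursion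
  divides only by leading coefficients.\<close>

lemma ex_linear_graded:
  fixes P :: "nat \<Rightarrow> 'a::field poly"
  assumes deg: "\<And>n. degree (P n) = n" and nz: "\<And>n. P n \<noteq> 0"
  shows "\<exists>l. Vector_Spaces.linear smult (*) l \<and> (\<forall>n. l (P n) = v n)"
proof (intro exI conjI allI)
  fix n
  have "coeff (P n) n \<noteq> 0"
    using deg[of n] nz[of n] leading_coeff_0_iff by metis
  then show "(\<Sum>i\<le>degree (P n). coeff (P n) i * graded_moment P v i) = v n"
    by (simp add: deg graded_moment.simps[of P v n] lessThan_Suc_atMost[symmetric])
qed (rule linear_moment_functional)

text \<open>Subtracting the multiple of \<open>P n\<close> with the same leading coefficient lowers
  the degree, and both functionals agree on what is subtracted.\<close>

lemma linear_graded_unique: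
  fixes P :: "nat \<Rightarrow> 'a::field poly"
  assumes deg: "\<And>n. degree (P n) = n" and nz: "\<And>n. P n \<noteq> 0"
    and lin: "Vector_Spaces.linear smult (*) l" "Vector_Spaces.linear smult (*) l'"
    and eq: "\<And>n. l (P n) = l' (P n)"
  shows "l = l'"
proof
  fix p
  have add: "f (a + b) = f a + f b" and scale: "f (smult c a) = c * f a"
    if "f = l \<or> f = l'" for f a b c
    using lin that unfolding linear_smult_iff by blast+
  show "l p = l' p"
  proof (induction "degree p" arbitrary: p rule: less_induct)
    case less
    define n where "n = degree p"
    define a where "a = lead_coeff p / lead_coeff (P n)"
    define r where "r = p - smult a (P n)"
    have p: "p = r + smult a (P n)"
      by (simp add: r_def)
    have "l r = l' r"
    \<comment> \<open>A zero remainder has \<open>degree\<close> 0, which is no decrease when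
      \<open>p\<close> is constant.\<close>
    proof (cases "r = 0")
      case True
      then show ?thesis
        using scale[of l 0 0] scale[of l' 0 0] by simp
    next
      case False
      have "coeff r n = 0"
        using nz[of n] leading_coeff_0_iff[of "P n"] by (simp add: r_def a_def n_def deg)
      moreover have "degree r \<le> n"
        unfolding r_def n_def
        by (rule degree_diff_le) (use degree_smult_le[of a "P n"] deg in \<open>auto simp: n_def\<close>)
      ultimately have "degree r < degree p"
        using False by (metis leading_coeff_0_iff n_def le_neq_implies_less)
      then show ?thesis by (rule less)
    qed
    then show ?case
      using eq by (subst (1 2) p) (simp add: add scale)
  qed
qed

section \<open>The recurrence of the \<open>q\<close>-Fibonacci polynomials\<close>

lemma qnum_add: "qnum x (m + n) = qnum x m + x ^ m * qnum x n"
  by (induction n) (simp_all add: qnum_def algebra_simps power_add)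

lemma qfact_Suc: "qfact x (Suc n) = qfact x n * qnum x (Suc n)"
  by (simp add: qfact_def)

lemma qbinom_eq_0: "n < k \<Longrightarrow> qbinom x n k = 0"
  by (simp add: qbinom_def)

context
  fixes x :: "'a::field"
  assumes qnum_nz: "\<And>m. 0 < m \<Longrightarrow> qnum x m \<noteq> 0"
begin

lemma qfact_nz: "qfact x n \<noteq> 0"
  by (simp add: qfact_def qnum_nz)

lemma qbinom_0 [simp]: "qbinom x n 0 = 1"
  using qfact_nz by (simp add: qbinom_def qfact_def)

lemma qbinom_self [simp]: "qbinom x n n = 1"
  using qfact_nz by (simp add: qbinom_def qfact_def)

text \<open>Writing \<open>[m]\<close> for \<open>qnum x m\<close>, this comes from splitting the
  top factor of the numerator as \<open>[n + 1] = [n - k] + x ^ (n - k) * [k + 1]\<close>.\<close>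

lemma qbinom_Suc_Suc:
  "qbinom x (Suc n) (Suc k) = qbinom x n (Suc k) + x ^ (n - k) * qbinom x n k"
proof (cases "k < n")
  case True
  then obtain d where n: "n = Suc (k + d)"
    using less_imp_Suc_add by blast
  have num: "qnum x (Suc (Suc (k + d))) = qnum x (Suc d) + x ^ Suc d * qnum x (Suc k)"
    using qnum_add[of x "Suc d" "Suc k"] by (simp add: add.commute)
  have "qfact x (Suc n) = qfact x n * (qnum x (Suc d) + x ^ Suc d * qnum x (Suc k))"
    unfolding n by (subst qfact_Suc) (simp only: num)
  moreover have "n - k = Suc d" "n - Suc k = d" "Suc n - Suc k = Suc d"
    by (simp_all add: n)
  ultimately show ?thesis
    using True qfact_nz[of k] qfact_nz[of d] qnum_nz[of "Suc k"] qnum_nz[of "Suc d"]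
    by (simp add: qbinom_def qfact_Suc field_simps)
next
  case False
  then consider "k = n" | "n < k" by linarith
  then show ?thesis
    by cases (simp_all add: qbinom_eq_0)
qed

text \<open>Beyond the summation range \<open>n - k < k\<close>, even with truncated subtraction, so
  the Gaussian binomial vanishes and no bound on \<open>k\<close> remains.\<close>

lemma coeff_qfib_Suc:
  "coeff (qfib (Suc n) x) k = x ^ (2 * (k choose 2)) * qbinom x (n - k) k"
proof (cases "k \<le> n div 2")
  case True
  then show ?thesis
    by (simp add: qfib_def coeff_sum)
next
  case False
  then have "n - k < k" by linarith
  with False show ?thesis
    by (simp add: qfib_def coeff_sum qbinom_eq_0)
qed

lemma qfib_recurrence:
  "qfib (n + 3) x = qfib (n + 2) x + monom (x ^ n) 1 * qfib (n + 1) x"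
proof (rule poly_eqI)
  fix k
  have F: "n + 3 = Suc (Suc (Suc n))" "n + 2 = Suc (Suc n)" "n + 1 = Suc n"
    by simp_all
  show "coeff (qfib (n + 3) x) k =
    coeff (qfib (n + 2) x + monom (x ^ n) 1 * qfib (n + 1) x) k"
  proof (cases k)
    case 0
    then show ?thesis
      unfolding F by (simp add: coeff_qfib_Suc coeff_monom_mult)
  next
    case (Suc j)
    have choose: "2 * (Suc j choose 2) = 2 * j + 2 * (j choose 2)"
      by (simp add: numeral_2_eq_2)
    \<comment> \<open>The coefficients of \<open>s ^ (j + 1)\<close> with the common factor
      \<open>x ^ (2 * (j choose 2))\<close> removed.\<close>
    have "x ^ (2 * j) * qbinom x (Suc n - j) (Suc j) =
        x ^ (2 * j) * qbinom x (n - j) (Suc j) + x ^ n * qbinom x (n - j) j"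
    proof (cases "2 * j \<le> n")
      case True
      \<comment> \<open>The power from the Pascal rule merges with \<open>x ^ (2 * j)\<close> into
        \<open>x ^ n\<close>. For \<open>2 * j > n\<close> truncation would spoil this, but then all
        three binomials are 0.\<close>
      then have "Suc n - j = Suc (n - j)" "x ^ n = x ^ (2 * j) * x ^ (n - j - j)"
        by (simp_all flip: power_add)
      then show ?thesis
        by (simp add: qbinom_Suc_Suc algebra_simps)
    next
      case False
      then show ?thesis
        by (simp add: qbinom_eq_0)
    qed
    from arg_cong[OF this, of "(*) (x ^ (2 * (j choose 2)))"] show ?thesis
      unfolding F Suc coeff_add coeff_monom_mult coeff_qfib_Suc choose power_add
      by (simp add: distrib_left mult_ac)
  qed
qed

text \<open>The binomial factor is \<open>qbinom x n n = 1\<close>, so the leading coefficient is a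
  pure power of \<open>x\<close>.\<close>

lemma coeff_qfib_odd: "coeff (qfib (2 * n + 1) x) n = x ^ (2 * (n choose 2))"
  using coeff_qfib_Suc[of "2 * n" n] by simp

lemma degree_qfib_odd:
  assumes "x \<noteq> 0"
  shows "degree (qfib (2 * n + 1) x) = n"
proof (rule antisym)
  show "degree (qfib (2 * n + 1) x) \<le> n"
    by (rule degree_le) (use coeff_qfib_Suc[of "2 * n"] in \<open>auto simp: qbinom_eq_0\<close>)
  show "n \<le> degree (qfib (2 * n + 1) x)"
    by (rule le_degree) (use assms in \<open>simp only: coeff_qfib_odd\<close>, simp)
qed

lemma qfib_1: "qfib 1 x = 1"
  by (simp add: qfib_def numeral_2_eq_2 flip: one_pCons)

lemma qfib_2: "qfib 2 x = 1"
  by (simp add: qfib_def numeral_2_eq_2 flip: one_pCons)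

end

section \<open>The functional \<open>L\<close>\<close>

lemma q_eq_to_fract: "q = to_fract [:0, 1:]"
  by (simp add: q_def to_fract_def)

lemma q_nz: "q \<noteq> 0"
  by (simp add: q_eq_to_fract)

lemma to_fract_power: "to_fract (p ^ n) = to_fract p ^ n"
  by (induction n) simp_all

lemma q_power_neq_1:
  assumes "0 < n"
  shows "q ^ n \<noteq> 1"
proof
  assume "q ^ n = 1"
  then have "([:0, 1:] :: rat poly) ^ n = 1"
    by (metis q_eq_to_fract to_fract_power to_fract_1 to_fract_eq_iff)
  then have "degree (([:0, 1:] :: rat poly) ^ n) = 0"
    by simp
  with assms show False
    by (simp add: degree_power_eq)
qed

text \<open>A zero of the geometric sum would make \<open>1 / q\<close> a root of unity. This
  discharges the standing assumption on \<open>x\<close> at \<open>x = 1 / q\<close>.\<close>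

lemma qnum_inverse_q_nz:
  assumes "0 < m"
  shows "qnum (1 / q) m \<noteq> 0"
proof
  assume "qnum (1 / q) m = 0"
  then have "(1 / q) ^ m = 1"
    using power_diff_1_eq[of "1 / q" m] by (simp add: qnum_def)
  then show False
    using q_power_neq_1[OF assms] by (simp add: power_one_over)
qed

text \<open>Justifies the definite description: the odd-indexed polynomials have degrees 0, 1, 2,
  ..., so their prescribed values determine exactly one functional.\<close>

lemma L_properties:
  "Vector_Spaces.linear smult (*) L \<and> L (qfib 1 (1 / q)) = 1 \<and>
   (\<forall>n\<ge>1. L (qfib (2 * n + 1) (1 / q)) = 0)"
proof -
  define P where "P n = qfib (2 * n + 1) (1 / q)" for n
  define v :: "nat \<Rightarrow> ratfun" where "v n = (if n = 0 then 1 else 0)" for n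
  have x: "1 / q \<noteq> 0"
    using q_nz by simp
  have deg: "degree (P n) = n" for n
    unfolding P_def by (rule degree_qfib_odd[OF qnum_inverse_q_nz x])
  have "coeff (P n) n \<noteq> 0" for n
    unfolding P_def using x by (simp only: coeff_qfib_odd[OF qnum_inverse_q_nz]) simp
  then have nz: "P n \<noteq> 0" for n
    by (metis coeff_0)
  have char: "l (qfib 1 (1 / q)) = 1 \<and> (\<forall>n\<ge>1. l (qfib (2 * n + 1) (1 / q)) = 0) \<longleftrightarrow>
      (\<forall>n. l (P n) = v n)" for l :: "ratfun poly \<Rightarrow> ratfun"
  proof -
    have "(\<forall>n. l (P n) = v n) \<longleftrightarrow> l (P 0) = v 0 \<and> (\<forall>n\<ge>1. l (P n) = v n)"
      by (metis less_one not_le)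
    then show ?thesis
      by (simp add: P_def v_def)
  qed
  have "\<exists>!l. Vector_Spaces.linear smult (*) l \<and> (\<forall>n. l (P n) = v n)"
    using ex_linear_graded[of P v] linear_graded_unique[of P] deg nz by (metis (lifting))
  from theI'[OF this] show ?thesis
    unfolding char L_def by simp
qed

lemma L_add: "L (p + r) = L p + L r" and L_smult: "L (smult c p) = c * L p"
  using L_properties unfolding linear_smult_iff by blast+

lemma L_qfib_odd: "1 \<le> n \<Longrightarrow> L (qfib (2 * n + 1) (1 / q)) = 0"
  using L_properties by blast

text \<open>Multiplying by \<open>q ^ n\<close> clears the factor \<open>(1 / q) ^ n\<close> of the
  Fibonacci recurrence.\<close>

lemma L_monom_qfib:
  "q ^ n * L (monom 1 m * qfib (n + 3) (1 / q)) =
   q ^ n * L (monom 1 m * qfib (n + 2) (1 / q)) + L (monom 1 (Suc m) * qfib (n + 1) (1 / q))"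
proof -
  have "monom 1 m * monom ((1 / q) ^ n) 1 = smult ((1 / q) ^ n) (monom 1 (Suc m))"
    by (simp add: mult_monom smult_monom)
  then have "monom 1 m * qfib (n + 3) (1 / q) = monom 1 m * qfib (n + 2) (1 / q) +
      smult ((1 / q) ^ n) (monom 1 (Suc m) * qfib (n + 1) (1 / q))"
    by (simp only: qfib_recurrence[OF qnum_inverse_q_nz] distrib_left mult.assoc[symmetric]
        mult_smult_left)
  then show ?thesis
    using q_nz by (simp add: L_add L_smult field_simps)
qed

section \<open>The recurrences for \<open>g\<close>\<close>

text \<open>Up to the boundary entry the closed forms remain valid: there \<open>L\<close> vanishes.\<close>

lemma g_even:
  assumes "1 \<le> n" "k \<le> n"
  shows "g (2 * n) (Suc k) =
    (- 1) ^ n * q ^ (2 * (k choose 2)) * L (monom 1 (n - k) * qfib (2 * k + 1) (1 / q))"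
proof (cases "k = n")
  case True
  have "monom 1 0 * p = p" for p :: "ratfun poly"
    by (simp add: monom_0)
  with True assms L_qfib_odd[of n] show ?thesis
    by (simp add: g_def)
next
  case False
  with assms show ?thesis
    by (simp add: g_def)
qed

lemma g_odd:
  assumes "k \<le> n"
  shows "g (2 * n + 1) (Suc k) =
    (- 1) ^ n * q ^ k\<^sup>2 * L (monom 1 (n - k) * qfib (2 * k + 2) (1 / q))"
  using assms by (simp add: g_def)

lemma two_choose_Suc_two: "2 * (Suc k choose 2) = 2 * k + 2 * (k choose 2)"
  by (simp add: numeral_2_eq_2)

text \<open>Compares the normalizing exponents of odd and even rows; their difference is the
  \<open>q ^ k\<close> in both recurrences.\<close>

lemma square_eq_add_two_choose: "k\<^sup>2 = k + 2 * (k choose 2)"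
  by (induction k) (simp_all add: two_choose_Suc_two power2_eq_square binomial_eq_0)

lemma g_even_recurrence:
  assumes "k < n"
  shows "g (2 * n) (Suc k) = g (2 * n) (Suc (Suc k)) + q ^ k * g (2 * n - 1) (Suc k)"
proof -
  obtain m where n: "n = Suc (k + m)"
    using assms less_imp_Suc_add by blast
  let ?c = "q ^ (2 * (k choose 2))"
  let ?A = "L (monom 1 m * qfib (2 * k + 3) (1 / q))"
  let ?B = "L (monom 1 m * qfib (2 * k + 2) (1 / q))"
  let ?C = "L (monom 1 (Suc m) * qfib (2 * k + 1) (1 / q))"
  \<comment> \<open>Up to the common factor \<open>(- 1) ^ n * ?c\<close>, the three entries are
    \<open>?C\<close>, \<open>q ^ (2 * k) * ?A\<close> and \<open>- q ^ (2 * k) * ?B\<close>. For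
    \<open>m = 0\<close>, \<open>?A\<close> is the boundary value.\<close>
  have rec: "q ^ (2 * k) * ?A = q ^ (2 * k) * ?B + ?C"
    by (rule L_monom_qfib)
  have e1: "g (2 * n) (Suc k) = (- 1) ^ n * ?c * ?C"
    using g_even[of n k] by (simp add: n)
  have e2: "g (2 * n) (Suc (Suc k)) = (- 1) ^ n * ?c * (q ^ (2 * k) * ?A)"
    using g_even[of n "Suc k"]
    by (simp add: n two_choose_Suc_two power_add numeral_3_eq_3 mult_ac)
  \<comment> \<open>This row belongs to \<open>n - 1\<close>, whose sign
    \<open>(- 1) ^ (n - 1)\<close> supplies the minus that moves \<open>?B\<close> across
    \<open>rec\<close>.\<close>
  have "2 * n - 1 = 2 * (k + m) + 1"
    by (simp add: n)
  then have e3: "q ^ k * g (2 * n - 1) (Suc k) = - ((- 1) ^ n * ?c * (q ^ (2 * k) * ?B))"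
    using g_odd[of k "k + m"]
    by (simp add: n square_eq_add_two_choose power_add mult_2 mult_2_right mult_ac)
  show ?thesis
    unfolding e1 e2 e3 rec by (simp add: algebra_simps)
qed

lemma g_odd_recurrence:
  assumes "1 \<le> n" "k \<le> n"
  shows "g (2 * n + 1) (Suc k) = q ^ k * g (2 * n) (Suc k) + g (2 * n + 1) k"
proof (cases k)
  case 0
  \<comment> \<open>In the first column the last term is the default 0, and the other two agree
    because \<open>F_1 = F_2 = 1\<close>.\<close>
  have "g (2 * n + 1) 0 = 0"
    by (simp add: g_def)
  with 0 assms show ?thesis
    using g_even[of n 0] g_odd[of 0 n] qfib_1[OF qnum_inverse_q_nz] qfib_2[OF qnum_inverse_q_nz]
    by (simp add: binomial_eq_0 numeral_2_eq_2)
next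
  case (Suc j)
  obtain m where n: "n = k + m"
    using assms le_Suc_ex by blast
  let ?A = "L (monom 1 m * qfib (2 * j + 1 + 3) (1 / q))"
  let ?B = "L (monom 1 m * qfib (2 * j + 1 + 2) (1 / q))"
  let ?C = "L (monom 1 (Suc m) * qfib (2 * j + 1 + 1) (1 / q))"
  have rec: "q ^ (2 * j + 1) * ?A = q ^ (2 * j + 1) * ?B + ?C"
    by (rule L_monom_qfib)
  have sq: "k\<^sup>2 = j\<^sup>2 + (2 * j + 1)"
    by (simp add: Suc power2_eq_square)
  have fib: "2 * k + 2 = 2 * j + 1 + 3" "2 * k + 1 = 2 * j + 1 + 2"
    by (simp_all add: Suc)
  have e1: "g (2 * n + 1) (Suc k) = (- 1) ^ n * q ^ j\<^sup>2 * (q ^ (2 * j + 1) * ?A)"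
    using g_odd[of k n] unfolding fib sq power_add by (simp add: n mult_ac)
  \<comment> \<open>The factor \<open>q ^ k\<close> turns the even-row normalization at
    \<open>k\<close> into the odd-row one, which exceeds that at \<open>j\<close> by the
    \<open>q ^ (2 * j + 1)\<close> of \<open>rec\<close>.\<close>
  have "q ^ k * q ^ (2 * (k choose 2)) = q ^ j\<^sup>2 * q ^ (2 * j + 1)"
    using sq square_eq_add_two_choose[of k] by (simp flip: power_add)
  then have e2: "q ^ k * g (2 * n) (Suc k) = (- 1) ^ n * q ^ j\<^sup>2 * (q ^ (2 * j + 1) * ?B)"
    using g_even[OF assms] unfolding fib by (simp add: n mult_ac)
  have e3: "g (2 * n + 1) k = (- 1) ^ n * q ^ j\<^sup>2 * ?C"
    using g_odd[of j n] by (simp add: n Suc)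
  show ?thesis
    unfolding e1 e2 e3 rec by (simp add: algebra_simps)
qed

lemma g_1_1: "g 1 1 = 1"
proof -
  have "qfib 2 (1 / q) = qfib 1 (1 / q)"
    by (simp only: qfib_1[OF qnum_inverse_q_nz] qfib_2[OF qnum_inverse_q_nz])
  then have "L (qfib 2 (1 / q)) = 1"
    using L_properties by simp
  then show ?thesis
    by (simp add: g_def monom_0)
qed

lemma g_2_1: "g 2 1 = 1"
proof -
  \<comment> \<open>Row 2 has a single entry in range, so the even recurrence reduces to
    \<open>g 2 1 = g 1 1\<close>.\<close>
  have "g 2 (Suc 1) = 0"
    by (simp add: g_def)
  then show ?thesis
    using g_even_recurrence[of 0 1] g_1_1 by simp
qed

theorem mainTheorem7:
  shows "g 1 1 = 1 \<and> g 2 1 = 1 \<and>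
    (\<forall>n\<ge>1.
      (\<forall>k. 1 \<le> k \<and> k \<le> n \<longrightarrow>
         g (2 * n) k = g (2 * n) (k + 1) + q ^ (k - 1) * g (2 * n - 1) k) \<and>
      (\<forall>k. 1 \<le> k \<and> k \<le> n + 1 \<longrightarrow>
         g (2 * n + 1) k = q ^ (k - 1) * g (2 * n) k + g (2 * n + 1) (k - 1)))"
proof (intro conjI allI impI)
  fix n k :: nat
  assume "1 \<le> k \<and> k \<le> n"
  then show "g (2 * n) k = g (2 * n) (k + 1) + q ^ (k - 1) * g (2 * n - 1) k"
    using g_even_recurrence[of "k - 1" n] by auto
next
  fix n k :: nat
  assume "1 \<le> n" "1 \<le> k \<and> k \<le> n + 1"
  then show "g (2 * n + 1) k = q ^ (k - 1) * g (2 * n) k + g (2 * n + 1) (k - 1)"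
    using g_odd_recurrence[of n "k - 1"] by auto
qed (rule g_1_1 g_2_1)+

end
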